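(* Let $A\in\mathbb{R}^{m\times n}$ with $m\ge n$ and $m>2$, with rows $a_1^T,\dots,a_m^T$, let $b\in\mathbb{R}^m$, and suppose the linear system $Ax=b$ is consistent. Assume that every row of $A$ is nonzero and that any two distinct rows of $A$ are linearly independent. Let $x^{(0)}\in R(A^T)$, let $x^*=A^{\dagger}b$ be the least-norm solution of $Ax=b$, and let $\{x^{(k)}\}_{k\ge1}$ be the random sequence generated from $x^{(0)}$ by the randomized Kaczmarz method with oblique projection (RKO) defined in the context. Then, for every $k\ge 2$, $$E_k\|x^{(k+1)}-x^*\|^2\le\left(1-\frac{\sigma_{\min}^2}{(m-2)\left(\|A\|_F^2-\sigma_{\min}^2\right)}\right)\|x^{(k)}-x^*\|^2,$$ and the method converges to $x^*$ in expectation, i.e. $E\|x^{(k)}-x^*\|^2\to 0$ as $k\to\infty$.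
   Context: Notation: $\langle\cdot,\cdot\rangle$ and $\|\cdot\|$ are the Euclidean inner product and norm; $\|A\|_F$ is the Frobenius norm; $\sigma_{\min}=\sigma_{\min}(A)$ is the smallest nonzero singular value of $A$; $R(A^T)$ is the range of $A^T$; $A^{\dagger}$ is the Moore-Penrose inverse of $A$; $b=(b_1,\dots,b_m)^T$. RKO method. Select random indices $i_1\in\{1,\dots,m\}$ and $i_2\in\{1,\dots,m\}\setminus\{i_1\}$ (with any distribution). For $k\ge 2$, given $i_1,\dots,i_k$, select $i_{k+1}$ uniformly at random from $\{1,\dots,m\}\setminus\{i_k,i_{k-1}\}$. Set $$x^{(1)}=x^{(0)}+\frac{b_{i_1}-\langle a_{i_1},x^{(0)}\rangle}{\|a_{i_1}\|^2}a_{i_1},$$ and for $k\ge 1$ set $$w^{(i_k)}=a_{i_{k+1}}-\frac{\langle a_{i_k},a_{i_{k+1}}\rangle}{\|a_{i_k}\|^2}a_{i_k},\qquad x^{(k+1)}=x^{(k)}+\frac{b_{i_{k+1}}-\langle a_{i_{k+1}},x^{(k)}\rangle}{\|w^{(i_k)}\|^2}\,w^{(i_k)}.$$ Linear independence of distinct rows guarantees $w^{(i_k)}\neq0$. $E_k$ denotes the conditional expectation given the first $k$ iterations, i.e. given $i_1,\dots,i_k$; $E$ denotes full expectation. *)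

theory Defs
  imports "HOL-Probability.Probability"
begin

definition frobenius_norm :: "real^'n^'m \<Rightarrow> real" where
  "frobenius_norm A = sqrt (\<Sum>i\<in>UNIV. \<Sum>j\<in>UNIV. (A $ i $ j)\<^sup>2)"

(* A singular value is the nonnegative square root of an eigenvalue of the Gram matrix
   transpose A ** A. *)
definition singular_value :: "real^'n^'m \<Rightarrow> real \<Rightarrow> bool" where
  "singular_value A s \<longleftrightarrow>
     s \<ge> 0 \<and> (\<exists>v. v \<noteq> 0 \<and> (transpose A ** A) *v v = s\<^sup>2 *\<^sub>R v)"

(* Smallest NONZERO singular value; unspecified only for A = 0. *)
definition sigma_min :: "real^'n^'m \<Rightarrow> real" where
  "sigma_min A = (LEAST s. singular_value A s \<and> s \<noteq> 0)"

(* The four Penrose equations, which determine X uniquely. *)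
definition moore_penrose :: "real^'n^'m \<Rightarrow> real^'m^'n \<Rightarrow> bool" where
  "moore_penrose A X \<longleftrightarrow>
     A ** X ** A = A \<and> X ** A ** X = X \<and>
     transpose (A ** X) = A ** X \<and> transpose (X ** A) = X ** A"

definition pinv :: "real^'n^'m \<Rightarrow> real^'m^'n" where
  "pinv A = (THE X. moore_penrose A X)"

(* The direction w for the consecutive row indices p = i_k, q = i_(k+1). *)
definition oblique_dir :: "real^'n^'m \<Rightarrow> 'm \<Rightarrow> 'm \<Rightarrow> real^'n" where
  "oblique_dir A p q =
     row q A - ((row p A \<bullet> row q A) / (norm (row p A))\<^sup>2) *\<^sub>R row p A"

(* Iterates for a fixed index sequence s. Selected indices are numbered from 1,
   so s 0 is never used. *)
fun rko :: "real^'n^'m \<Rightarrow> real^'m \<Rightarrow> real^'n \<Rightarrow> (nat \<Rightarrow> 'm) \<Rightarrow> nat \<Rightarrow> real^'n" where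
  "rko A b x0 s 0 = x0"
| "rko A b x0 s (Suc 0) =
     x0 + ((b $ s 1 - row (s 1) A \<bullet> x0) / (norm (row (s 1) A))\<^sup>2) *\<^sub>R row (s 1) A"
| "rko A b x0 s (Suc (Suc k)) =
     (let x = rko A b x0 s (Suc k);
          p = s (Suc k);
          q = s (Suc (Suc k));
          w = oblique_dir A p q
      in x + ((b $ q - row q A \<bullet> x) / (norm w)\<^sup>2) *\<^sub>R w)"

(* The joint law of (i 1, i 2) is arbitrary subject to i 1 and i 2 being distinct.
   For k at least 2, the law of i (k+1) given any history h of positive probability is
   uniform on all indices other than h k and h (k-1). *)
definition rko_selection :: "'w measure \<Rightarrow> (nat \<Rightarrow> 'w \<Rightarrow> 'm::finite) \<Rightarrow> bool" where
  "rko_selection M i \<longleftrightarrow>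
     (\<forall>k\<ge>1. i k \<in> measurable M (count_space UNIV)) \<and>
     (AE \<omega> in M. i 1 \<omega> \<noteq> i 2 \<omega>) \<and>
     (\<forall>k\<ge>2. \<forall>h j.
        \<P>(\<omega> in M. \<forall>l\<in>{1..k}. i l \<omega> = h l) \<noteq> 0 \<longrightarrow>
        \<P>(\<omega> in M. i (k + 1) \<omega> = j \<bar> \<forall>l\<in>{1..k}. i l \<omega> = h l) =
          pmf (pmf_of_set (UNIV - {h k, h (k - 1)})) j)"

(* The sigma-algebra generated by i 1, ..., i k; E_k is real_cond_exp M (history M i k). *)
definition history :: "'w measure \<Rightarrow> (nat \<Rightarrow> 'w \<Rightarrow> 'm) \<Rightarrow> nat \<Rightarrow> 'w measure" where
  "history M i k = sigma (space M) {i l -` S \<inter> space M | l S. l \<in> {1..k}}"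

end

theory Submission
  imports Defs
begin

text \<open>
  Write \<open>e\<^sub>k\<close> for the error of the \<open>k\<close>-th iterate, \<open>p\<close> for the last selected index and
  \<open>w\<^sub>q\<close> for the direction of a step to row \<open>q\<close>. As \<open>w\<^sub>q\<close> is the component of row \<open>q\<close> orthogonal to
  row \<open>p\<close>, the error \<open>e\<^sub>k\<close> is orthogonal to the last two selected rows, and a step
  to \<open>q\<close> decreases the squared error by \<open>\<langle>a\<^sub>q, e\<^sub>k\<rangle>\<^sup>2 / \<parallel>w\<^sub>q\<parallel>\<^sup>2\<close>. The two excluded rows contribute
  nothing, so the expected decrease is \<open>1 / (m - 2)\<close> times the sum over all rows. Each
  \<open>\<parallel>w\<^sub>q\<parallel>\<^sup>2\<close> is at most their sum \<open>\<parallel>A\<parallel>\<^sup>2 - \<parallel>A a\<^sub>p\<parallel>\<^sup>2 / \<parallel>a\<^sub>p\<parallel>\<^sup>2\<close> (Frobenius norm of \<open>A\<close>), hence at most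
  \<open>\<parallel>A\<parallel>\<^sup>2 - \<sigma>\<^sup>2\<close>, while the sum of the \<open>\<langle>a\<^sub>q, e\<^sub>k\<rangle>\<^sup>2\<close> is \<open>\<parallel>A e\<^sub>k\<parallel>\<^sup>2 \<ge> \<sigma>\<^sup>2 \<parallel>e\<^sub>k\<parallel>\<^sup>2\<close>; both
  estimates use that \<open>\<parallel>A x\<parallel> \<ge> \<sigma> \<parallel>x\<parallel>\<close> on the row space, where \<open>\<sigma>\<^sup>2\<close> is the minimum of the
  Rayleigh quotient of the Gram matrix. The history has only finitely many
  values, so the conditional expectation is a finite sum.
\<close>

section \<open>The Moore-Penrose inverse\<close>

text \<open>As a simp rule it rewrites \<open>transpose A *v y\<close> to \<open>y v* A\<close>;
  keeping the transpose leaves \<open>transpose_mult_inner\<close> applicable.\<close>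

declare transpose_matrix_vector [simp del]

lemma transpose_mult_inner:
  fixes A :: "real^'n^'m"
  shows "(transpose A *v y) \<bullet> x = y \<bullet> (A *v x)"
  by (simp add: transpose_matrix_vector dot_lmul_matrix)

lemma subspace_range_transpose:
  fixes A :: "real^'n^'m"
  shows "subspace (range (\<lambda>y. transpose A *v y))"
  by (intro linear_subspace_image matrix_vector_mul_linear subspace_UNIV)

text \<open>The range of the transpose is orthogonal to the kernel of \<open>A\<close>, so the two
  share only 0.\<close>

lemma matrix_vector_mult_inj_on_range_transpose:
  fixes A :: "real^'n^'m"
  assumes "x \<in> range (\<lambda>y. transpose A *v y)" and "A *v x = 0"
  shows "x = 0"
proof -
  obtain y where "x = transpose A *v y" using assms(1) by auto
  then have "x \<bullet> x = 0" using assms(2) by (simp add: transpose_mult_inner)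
  then show ?thesis by simp
qed

lemma gram_mult_eq_0_iff:
  fixes A :: "real^'n^'m"
  shows "transpose A *v (A *v x) = 0 \<longleftrightarrow> A *v x = 0"
proof
  assume "transpose A *v (A *v x) = 0"
  then have "(A *v x) \<bullet> (A *v x) = 0" by (metis transpose_mult_inner inner_zero_left)
  then show "A *v x = 0" by simp
qed simp

lemma matrix_eq_iff_inner:
  fixes B C :: "real^'n^'m"
  shows "B = C \<longleftrightarrow> (\<forall>x y. (B *v x) \<bullet> y = (C *v x) \<bullet> y)"
  by (metis matrix_eq vector_eq_rdot)

lemma transpose_eq_self_iff:
  fixes B :: "real^'n^'n"
  shows "transpose B = B \<longleftrightarrow> (\<forall>x y. (B *v x) \<bullet> y = x \<bullet> (B *v y))"
  by (metis matrix_eq_iff_inner transpose_mult_inner)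

text \<open>The normal equation, solved within the row space, defines the Moore-Penrose inverse.\<close>

lemma ex1_normal_equation:
  fixes A :: "real^'n^'m"
  shows "\<exists>!x. x \<in> range (\<lambda>y. transpose A *v y) \<and> transpose A *v (A *v x) = transpose A *v y"
    (is "\<exists>!x. x \<in> ?V \<and> _ x")
proof (rule ex_ex1I)
  \<comment> \<open>Two orthogonal splittings: \<open>v\<close>, the part of \<open>y\<close>
    orthogonal to the range of \<open>A\<close>, is killed by the transpose, so \<open>z\<close>
    solves the equation; \<open>t\<close>, the part of \<open>z\<close> orthogonal to the row space,
    is killed by \<open>A\<close>, so \<open>x\<close> still solves it.\<close>
  obtain u v where uv: "u \<in> span (range (\<lambda>x. A *v x))" "y = u + v"
    "\<And>w. w \<in> span (range (\<lambda>x. A *v x)) \<Longrightarrow> orthogonal v w"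
    using orthogonal_subspace_decomp_exists[of "range (\<lambda>x. A *v x)" y] by metis
  have "span (range (\<lambda>x. A *v x)) = range (\<lambda>x. A *v x)"
    by (intro span_eq_iff[THEN iffD2] linear_subspace_image matrix_vector_mul_linear subspace_UNIV)
  with uv obtain z where z: "u = A *v z" by auto
  have "(transpose A *v v) \<bullet> x = 0" for x
    using uv(3)[of "A *v x"] by (simp add: transpose_mult_inner orthogonal_def span_base)
  then have v0: "transpose A *v v = 0" by (metis inner_eq_zero_iff)
  obtain x t where xt: "x \<in> span ?V" "z = x + t" "\<And>w. w \<in> span ?V \<Longrightarrow> orthogonal t w"
    using orthogonal_subspace_decomp_exists[of ?V z] by metis
  have "y \<bullet> (A *v t) = 0" for y
    using xt(3)[of "transpose A *v y"]
    by (simp add: transpose_mult_inner orthogonal_def span_base inner_commute[of t])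
  then have t0: "A *v t = 0" by (metis inner_eq_zero_iff)
  have "x \<in> ?V" using xt(1) subspace_range_transpose span_eq_iff by blast
  moreover have "transpose A *v (A *v x) = transpose A *v y"
    using uv(2) z xt(2) v0 t0 by (simp add: matrix_vector_right_distrib)
  ultimately show "\<exists>x. x \<in> ?V \<and> transpose A *v (A *v x) = transpose A *v y" by blast
next
  fix x x' assume *: "x \<in> ?V \<and> transpose A *v (A *v x) = transpose A *v y"
    "x' \<in> ?V \<and> transpose A *v (A *v x') = transpose A *v y"
  then have "x - x' \<in> ?V" using subspace_range_transpose subspace_diff by blast
  moreover have "transpose A *v (A *v (x - x')) = 0"
    using * by (simp add: matrix_vector_mult_diff_distrib)
  ultimately show "x = x'"
    using gram_mult_eq_0_iff matrix_vector_mult_inj_on_range_transpose eq_iff_diff_eq_0 by metis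
qed

text \<open>The witness is the solution operator \<open>T\<close> of the normal equation. Following
  \<open>T\<close> by \<open>A\<close> projects orthogonally onto the range of \<open>A\<close>,
  following \<open>A\<close> by \<open>T\<close> onto the row space; hence both products are
  symmetric.\<close>

lemma moore_penrose_exists:
  fixes A :: "real^'n^'m"
  shows "\<exists>X. moore_penrose A X"
proof -
  define V where "V = range (\<lambda>y. transpose A *v y)"
  define T where "T y = (THE x. x \<in> V \<and> transpose A *v (A *v x) = transpose A *v y)" for y
  have T: "T y \<in> V" "transpose A *v (A *v T y) = transpose A *v y" for y
    using theI'[OF ex1_normal_equation[of A y]] unfolding T_def V_def by auto
  have T_eqI: "T y = x" if "x \<in> V" "transpose A *v (A *v x) = transpose A *v y" for x y
    using ex1_normal_equation[of A y] T that unfolding V_def by blast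
  have sub: "subspace V" unfolding V_def by (rule subspace_range_transpose)
  \<comment> \<open>Sums and multiples of solutions are solutions in \<open>V\<close>, so uniqueness
    forces linearity.\<close>
  have "linear T"
    by (rule linearI; rule T_eqI)
      (auto simp: T sub subspace_add subspace_scale matrix_vector_right_distrib
        matrix_vector_mult_scaleR)
  then have X: "matrix T *v y = T y" for y by (simp add: matrix_works)
  have AT: "A *v T (A *v v) = A *v v" for v
  proof -
    have "transpose A *v (A *v (T (A *v v) - v)) = 0"
      using T(2)[of "A *v v"] by (simp add: matrix_vector_mult_diff_distrib)
    then have "A *v (T (A *v v) - v) = 0" by (simp only: gram_mult_eq_0_iff)
    then show ?thesis by (simp add: matrix_vector_mult_diff_distrib)
  qed
  have TA: "T (A *v v) = v" if "v \<in> V" for v using that by (intro T_eqI) auto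
  \<comment> \<open>\<open>res\<close> and \<open>V_inner\<close> state that
    \<open>z - A *v T z\<close> is orthogonal to the range of \<open>A\<close>, and
    \<open>z - T (A *v z)\<close> to \<open>V\<close>. They bring both sides of the symmetry claims
    to one symmetric expression.\<close>
  have res: "(A *v T y) \<bullet> z = (A *v T y) \<bullet> (A *v T z)" for y z
    using T(2)[of z] by (metis inner_commute transpose_mult_inner)
  have V_inner: "v \<bullet> z = v \<bullet> T (A *v z)" if "v \<in> V" for v z
    using that AT by (auto simp: V_def transpose_mult_inner)
  have "(A *v T y) \<bullet> z = y \<bullet> (A *v T z)" for y z
    by (metis res inner_commute)
  moreover have "T (A *v y) \<bullet> z = y \<bullet> T (A *v z)" for y z
    by (metis V_inner T(1) inner_commute)
  ultimately have "moore_penrose A (matrix T)"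
    unfolding moore_penrose_def transpose_eq_self_iff
    by (auto simp: matrix_eq X AT TA T simp flip: matrix_vector_mul_assoc)
  then show ?thesis ..
qed

text \<open>Penrose's argument: symmetry permits reversing products, which identifies the two
  projections, \<open>A ** X = A ** Y\<close> and \<open>X ** A = Y ** A\<close>; then
  \<open>X = X A X = X A Y = Y A Y = Y\<close>.\<close>

lemma moore_penrose_unique:
  fixes A :: "real^'n^'m"
  assumes X: "moore_penrose A X" and Y: "moore_penrose A Y"
  shows "X = Y"
proof -
  have AXY: "A ** X = A ** Y"
  proof -
    have "A ** X = transpose ((A ** Y ** A) ** X)"
      using X Y by (simp add: moore_penrose_def)
    also have "\<dots> = transpose (A ** X) ** transpose (A ** Y)"
      by (simp add: matrix_transpose_mul matrix_mul_assoc)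
    also have "\<dots> = (A ** X ** A) ** Y"
      using X Y by (simp add: moore_penrose_def matrix_mul_assoc)
    finally show ?thesis using X by (simp add: moore_penrose_def)
  qed
  have XYA: "X ** A = Y ** A"
  proof -
    have "X ** A = transpose (X ** (A ** Y ** A))"
      using X Y by (simp add: moore_penrose_def)
    also have "\<dots> = transpose (Y ** A) ** transpose (X ** A)"
      by (simp add: matrix_transpose_mul matrix_mul_assoc)
    also have "\<dots> = (Y ** A) ** (X ** A)"
      using X Y by (simp add: moore_penrose_def)
    also have "\<dots> = Y ** (A ** X ** A)"
      by (simp only: matrix_mul_assoc)
    finally show ?thesis using X by (simp add: moore_penrose_def)
  qed
  have "X = X ** (A ** X)" using X by (simp add: moore_penrose_def matrix_mul_assoc)
  also have "\<dots> = (X ** A) ** Y" by (simp add: AXY matrix_mul_assoc)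
  also have "\<dots> = Y" using Y by (simp add: XYA moore_penrose_def)
  finally show ?thesis .
qed

lemma moore_penrose_pinv: "moore_penrose A (pinv A)"
  unfolding pinv_def by (metis moore_penrose_exists moore_penrose_unique theI)

text \<open>Symmetry of \<open>pinv A ** A\<close> moves a transpose of \<open>A\<close> to the
  front of \<open>pinv A ** A ** pinv A\<close>. This keeps the errors in the row space, where
  \<open>A\<close> is bounded below.\<close>

lemma pinv_mult_in_range_transpose:
  fixes A :: "real^'n^'m"
  shows "pinv A *v b \<in> range (\<lambda>y. transpose A *v y)"
proof -
  have "pinv A = transpose (pinv A ** A) ** pinv A"
    using moore_penrose_pinv[of A] by (simp add: moore_penrose_def)
  then have "pinv A *v b = transpose A *v (transpose (pinv A) *v (pinv A *v b))"
    by (metis matrix_transpose_mul matrix_vector_mul_assoc)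
  then show ?thesis by blast
qed

lemma pinv_solves:
  fixes A :: "real^'n^'m"
  assumes "\<exists>x. A *v x = b"
  shows "A *v (pinv A *v b) = b"
  using assms moore_penrose_pinv[of A]
  by (metis matrix_vector_mul_assoc moore_penrose_def)

section \<open>The smallest nonzero singular value\<close>

text \<open>Restricting to the row space excludes the kernel, so the minimum is positive. It is
  attained on the compact unit sphere of that space and extends to all its vectors by
  homogeneity.\<close>

lemma Rayleigh_minimum:
  fixes A :: "real^'n^'m"
  assumes "A \<noteq> 0"
  obtains v where "v \<in> range (\<lambda>y. transpose A *v y)" "norm v = 1"
    "\<And>u. u \<in> range (\<lambda>y. transpose A *v y) \<Longrightarrow> norm (A *v v) * norm u \<le> norm (A *v u)"
proof -
  define V where "V = range (\<lambda>y. transpose A *v y)"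
  have sub: "subspace V" unfolding V_def by (rule subspace_range_transpose)
  obtain x where "A *v x \<noteq> 0" using assms by (metis matrix_eq matrix_vector_mult_0)
  then have "transpose A *v (A *v x) \<noteq> 0" by (simp only: gram_mult_eq_0_iff not_False_eq_True)
  then obtain z where z: "z \<in> V" "z \<noteq> 0" unfolding V_def by blast
  have "compact (sphere 0 1 \<inter> V)"
    by (intro compact_Int_closed compact_sphere closed_subspace sub)
  moreover have "sphere 0 1 \<inter> V \<noteq> {}"
  proof -
    have "(1 / norm z) *\<^sub>R z \<in> sphere 0 1 \<inter> V" using z sub by (auto simp: subspace_scale)
    then show ?thesis by blast
  qed
  moreover have "continuous_on (sphere 0 1 \<inter> V) (\<lambda>x. norm (A *v x))"
    by (intro continuous_intros linear_continuous_on linear_linear[THEN iffD2] matrix_vector_mul_linear)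
  ultimately obtain v where v: "v \<in> sphere 0 1 \<inter> V"
    "\<And>u. u \<in> sphere 0 1 \<inter> V \<Longrightarrow> norm (A *v v) \<le> norm (A *v u)"
    using continuous_attains_inf by metis
  have "norm (A *v v) * norm u \<le> norm (A *v u)" if "u \<in> V" for u
  proof (cases "u = 0")
    case False
    have "(1 / norm u) *\<^sub>R u \<in> sphere 0 1 \<inter> V" using that False sub by (auto simp: subspace_scale)
    from v(2)[OF this] show ?thesis using False
      by (simp add: matrix_vector_mult_scaleR field_simps)
  qed simp
  then show ?thesis using that v(1) unfolding V_def by auto
qed

text \<open>The residual \<open>u\<close> of the eigenvalue equation lies in \<open>V\<close>, so
  \<open>v\<close> may be perturbed along \<open>u\<close>. The first-order change is
  \<open>2 * t * (norm u)\<^sup>2\<close>, which a small negative \<open>t\<close> exploits unless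
  \<open>u = 0\<close>.\<close>

lemma Rayleigh_minimizer_eigenvector:
  fixes A :: "real^'n^'m"
  defines "V \<equiv> range (\<lambda>y. transpose A *v y)"
  assumes v: "v \<in> V" "norm v = 1"
    and min: "\<And>u. u \<in> V \<Longrightarrow> norm (A *v v) * norm u \<le> norm (A *v u)"
  shows "transpose A *v (A *v v) = (norm (A *v v))\<^sup>2 *\<^sub>R v"
proof -
  define \<mu> where "\<mu> = (norm (A *v v))\<^sup>2"
  define u where "u = transpose A *v (A *v v) - \<mu> *\<^sub>R v"
  have sub: "subspace V" unfolding V_def by (rule subspace_range_transpose)
  have u: "u \<in> V" unfolding u_def
    by (intro subspace_diff[OF sub] subspace_scale[OF sub] v) (simp add: V_def)
  define q where "q = (norm (A *v u))\<^sup>2 - \<mu> * (norm u)\<^sup>2"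
  \<comment> \<open>first variation of the Rayleigh quotient at \<open>v\<close> in the direction \<open>u\<close>\<close>
  have pos: "0 \<le> 2 * t * (norm u)\<^sup>2 + t\<^sup>2 * q" for t
  proof -
    have "v + t *\<^sub>R u \<in> V" using sub u v by (simp add: subspace_add subspace_scale)
    then have "(norm (A *v v) * norm (v + t *\<^sub>R u))\<^sup>2 \<le> (norm (A *v (v + t *\<^sub>R u)))\<^sup>2"
      by (intro power_mono min) auto
    then have "\<mu> * (norm (v + t *\<^sub>R u))\<^sup>2 \<le> (norm (A *v v + t *\<^sub>R (A *v u)))\<^sup>2"
      by (simp add: \<mu>_def power_mult_distrib matrix_vector_right_distrib matrix_vector_mult_scaleR)
    moreover have "(norm (v + t *\<^sub>R u))\<^sup>2 = 1 + 2 * t * (v \<bullet> u) + t\<^sup>2 * (norm u)\<^sup>2"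
      using v(2) by (simp add: power2_norm_eq_inner norm_eq_1 inner_simps inner_commute
        power2_eq_square[of t] algebra_simps)
    moreover have "(norm (A *v v + t *\<^sub>R (A *v u)))\<^sup>2
        = \<mu> + 2 * t * ((A *v v) \<bullet> (A *v u)) + t\<^sup>2 * (norm (A *v u))\<^sup>2"
      by (simp add: \<mu>_def power2_norm_eq_inner inner_simps inner_commute
        power2_eq_square[of t] algebra_simps)
    moreover have "(A *v v) \<bullet> (A *v u) - \<mu> * (v \<bullet> u) = (norm u)\<^sup>2"
      by (simp add: u_def transpose_mult_inner[symmetric] power2_norm_eq_inner inner_diff_left)
    ultimately show ?thesis unfolding q_def by (simp add: algebra_simps)
  qed
  have "(norm u)\<^sup>2 \<le> 0"
  proof (rule ccontr)
    assume "\<not> (norm u)\<^sup>2 \<le> 0"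
    define n where "n = (norm u)\<^sup>2"
    have n: "n > 0" using \<open>\<not> _\<close> by (simp add: n_def)
    \<comment> \<open>Negative, and so small that the quadratic term offsets at most half of the
      linear one; the summand 1 covers \<open>q = 0\<close>.\<close>
    define t where "t = - n / (\<bar>q\<bar> + 1)"
    have t: "t < 0" "\<bar>t\<bar> * \<bar>q\<bar> \<le> n" using n by (auto simp: t_def field_simps)
    have "t\<^sup>2 * q \<le> \<bar>t\<bar> * (\<bar>t\<bar> * \<bar>q\<bar>)"
      by (simp add: power2_eq_square mult_left_mono flip: mult.assoc)
    also have "\<dots> \<le> \<bar>t\<bar> * n" using t by (intro mult_left_mono) auto
    finally have "2 * t * n + t\<^sup>2 * q \<le> t * n" using t by (simp add: algebra_simps)
    also have "\<dots> < 0" using t n by (simp add: mult_neg_pos)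
    finally show False using pos[of t] by (simp add: n_def)
  qed
  then show ?thesis by (simp add: u_def \<mu>_def)
qed

text \<open>A \<open>LEAST\<close> over the reals is meaningful only once a minimum is exhibited;
  here it is the Rayleigh minimum, from which both claims follow.\<close>

lemma sigma_min_pos_and_le:
  fixes A :: "real^'n^'m"
  assumes "A \<noteq> 0"
  shows "sigma_min A > 0"
    and "x \<in> range (\<lambda>y. transpose A *v y) \<Longrightarrow> sigma_min A * norm x \<le> norm (A *v x)"
proof -
  obtain v where v: "v \<in> range (\<lambda>y. transpose A *v y)" "norm v = 1"
    and min: "\<And>u. u \<in> range (\<lambda>y. transpose A *v y) \<Longrightarrow> norm (A *v v) * norm u \<le> norm (A *v u)"
    using Rayleigh_minimum[OF assms] by metis
  have pos: "norm (A *v v) > 0"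
    using matrix_vector_mult_inj_on_range_transpose[OF v(1)] v(2) by auto
  have "sigma_min A = norm (A *v v)"
    unfolding sigma_min_def
  proof (rule Least_equality)
    have "(transpose A ** A) *v v = (norm (A *v v))\<^sup>2 *\<^sub>R v"
      using Rayleigh_minimizer_eigenvector[OF v min] by (simp flip: matrix_vector_mul_assoc)
    then show "singular_value A (norm (A *v v)) \<and> norm (A *v v) \<noteq> 0"
      unfolding singular_value_def using v(2) pos by (metis norm_ge_zero norm_zero zero_neq_one less_irrefl)
  next
    fix s assume "singular_value A s \<and> s \<noteq> 0"
    then obtain u where s: "s > 0" and u: "u \<noteq> 0" "transpose A *v (A *v u) = s\<^sup>2 *\<^sub>R u"
      unfolding singular_value_def by (force simp flip: matrix_vector_mul_assoc)
    \<comment> \<open>An eigenvector for a nonzero eigenvalue lies in the row space and so competes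
      in the minimum.\<close>
    have "u = transpose A *v ((1 / s\<^sup>2) *\<^sub>R (A *v u))"
      using s u by (simp add: matrix_vector_mult_scaleR)
    then have "norm (A *v v) * norm u \<le> norm (A *v u)" by (intro min) blast
    moreover have "(norm (A *v u))\<^sup>2 = (s * norm u)\<^sup>2"
      by (simp add: power2_norm_eq_inner transpose_mult_inner[symmetric] u(2) power_mult_distrib)
    then have "norm (A *v u) = s * norm u" using s by (simp add: power2_eq_iff_nonneg)
    ultimately show "norm (A *v v) \<le> s" using u(1) by simp
  qed
  then show "sigma_min A > 0"
    and "x \<in> range (\<lambda>y. transpose A *v y) \<Longrightarrow> sigma_min A * norm x \<le> norm (A *v x)"
    using pos min by auto
qed

section \<open>Oblique projections and the error recursion\<close>

lemma row_inner_oblique_dir: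
  fixes A :: "real^'n^'m"
  assumes "row p A \<noteq> 0"
  shows "row p A \<bullet> oblique_dir A p q = 0"
  using assms by (simp add: oblique_dir_def inner_diff_right power2_norm_eq_inner)

text \<open>Pythagoras for the splitting of row \<open>q\<close> along row \<open>p\<close>. The
  second identity is why a step scaled by the squared norm of a nonzero direction solves equation
  \<open>q\<close>.\<close>

lemma norm_oblique_dir:
  fixes A :: "real^'n^'m"
  assumes "row p A \<noteq> 0"
  shows "(norm (oblique_dir A p q))\<^sup>2 = (norm (row q A))\<^sup>2 - (row p A \<bullet> row q A)\<^sup>2 / (norm (row p A))\<^sup>2"
    and "row q A \<bullet> oblique_dir A p q = (norm (oblique_dir A p q))\<^sup>2"
proof -
  let ?w = "oblique_dir A p q" and ?c = "(row p A \<bullet> row q A) / (norm (row p A))\<^sup>2"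
  have q: "row q A = ?w + ?c *\<^sub>R row p A" by (simp add: oblique_dir_def)
  have "row q A \<bullet> ?w = ?w \<bullet> ?w + ?c * (row p A \<bullet> ?w)"
    by (subst q) (simp only: inner_add_left inner_scaleR_left)
  then show *: "row q A \<bullet> ?w = (norm ?w)\<^sup>2"
    using row_inner_oblique_dir[OF assms] by (simp add: power2_norm_eq_inner)
  have "row q A \<bullet> ?w = (norm (row q A))\<^sup>2 - (row p A \<bullet> row q A)\<^sup>2 / (norm (row p A))\<^sup>2"
    by (simp add: oblique_dir_def inner_diff_right power2_norm_eq_inner inner_commute
        power2_eq_square[of "row p A \<bullet> row q A"])
  then show "(norm ?w)\<^sup>2 = (norm (row q A))\<^sup>2 - (row p A \<bullet> row q A)\<^sup>2 / (norm (row p A))\<^sup>2"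
    using * by simp
qed

text \<open>A zero direction makes row \<open>q\<close> a multiple of row \<open>p\<close>.
  Inequality of the rows is a separate hypothesis because equal rows would collapse the set to a
  singleton.\<close>

lemma oblique_dir_nonzero:
  fixes A :: "real^'n^'m"
  assumes "row p A \<noteq> row q A" and "independent {row p A, row q A}"
  shows "oblique_dir A p q \<noteq> 0"
proof
  assume "oblique_dir A p q = 0"
  then have "row q A \<in> span {row p A}"
    unfolding oblique_dir_def by (metis eq_iff_diff_eq_0 insertI1 span_base span_scale)
  moreover have "{row p A, row q A} - {row q A} = {row p A}" using assms(1) by auto
  ultimately show False using assms(2) unfolding dependent_def by auto
qed

lemma sum_row_inner_power2:
  fixes A :: "real^'n^'m"
  shows "(\<Sum>q\<in>UNIV. (row q A \<bullet> x)\<^sup>2) = (norm (A *v x))\<^sup>2"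
proof -
  have "row q A = A $ q" for q by (simp add: row_def vec_eq_iff)
  then show ?thesis
    by (simp add: norm_vec_def L2_set_def sum_nonneg matrix_vector_mul_component)
qed

lemma frobenius_norm_power2:
  fixes A :: "real^'n^'m"
  shows "(frobenius_norm A)\<^sup>2 = (\<Sum>q\<in>UNIV. (norm (row q A))\<^sup>2)"
  by (simp add: frobenius_norm_def norm_vec_def L2_set_def sum_nonneg row_def)

text \<open>The rows lie in the range of the transpose, which is why \<open>\<sigma>\<^sub>m\<^sub>i\<^sub>n\<close> bounds
  the norm of \<open>A *v row p A\<close> from below.\<close>

lemma sum_norm_oblique_dir:
  fixes A :: "real^'n^'m"
  assumes "row p A \<noteq> 0"
  shows "(\<Sum>q\<in>UNIV. (norm (oblique_dir A p q))\<^sup>2) \<le> (frobenius_norm A)\<^sup>2 - (sigma_min A)\<^sup>2"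
proof -
  have A: "A \<noteq> 0" using assms by (auto simp: row_def vec_eq_iff)
  have "row p A = transpose A *v axis p 1"
    by (simp add: matrix_vector_mult_basis column_transpose)
  then have "sigma_min A * norm (row p A) \<le> norm (A *v row p A)"
    using sigma_min_pos_and_le(2)[OF A] by blast
  then have "(sigma_min A * norm (row p A))\<^sup>2 \<le> (norm (A *v row p A))\<^sup>2"
    using sigma_min_pos_and_le(1)[OF A] by (intro power_mono) auto
  then have "(sigma_min A)\<^sup>2 \<le> (norm (A *v row p A))\<^sup>2 / (norm (row p A))\<^sup>2"
    using assms by (simp add: power_mult_distrib field_simps)
  then show ?thesis
    by (simp add: norm_oblique_dir(1)[OF assms] sum_subtractf frobenius_norm_power2
        inner_commute[of "row p A"] sum_row_inner_power2 flip: sum_divide_distrib)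
qed

section \<open>The iterates and their errors\<close>

lemma rko_in_range_transpose:
  fixes A :: "real^'n^'m"
  assumes "x0 \<in> range (\<lambda>y. transpose A *v y)"
  shows "rko A b x0 s k \<in> range (\<lambda>y. transpose A *v y)"
proof -
  let ?V = "range (\<lambda>y. transpose A *v y)"
  have sub: "subspace ?V" by (rule subspace_range_transpose)
  have row: "row p A \<in> ?V" for p
    by (metis matrix_vector_mult_basis column_transpose rangeI)
  then have w: "oblique_dir A p q \<in> ?V" for p q
    unfolding oblique_dir_def by (intro subspace_diff subspace_scale sub)
  show ?thesis
    by (induction k rule: induct_nat_012)
      (use assms in \<open>simp_all add: Let_def subspace_add subspace_scale sub row w\<close>)
qed

text \<open>Lets a whole index path be replaced by its finite prefix, so that an iterate becomes a
  function of the history.\<close>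

lemma rko_cong:
  assumes "\<And>l. l \<in> {1..k} \<Longrightarrow> s l = t l"
  shows "rko A b x0 s k = rko A b x0 t k"
  using assms
proof (induction A b x0 s k rule: rko.induct)
  case (3 A b x0 s k)
  then have "rko A b x0 s (Suc k) = rko A b x0 t (Suc k)" by simp
  moreover have "s (Suc k) = t (Suc k)" "s (Suc (Suc k)) = t (Suc (Suc k))" using 3 by auto
  ultimately show ?case by simp
qed simp_all

lemma rko_error_step:
  fixes A :: "real^'n^'m"
  assumes "A *v z = b"
  shows "rko A b x0 s (Suc (Suc k)) - z =
    (rko A b x0 s (Suc k) - z)
      - ((row (s (Suc (Suc k))) A \<bullet> (rko A b x0 s (Suc k) - z)) /
          (norm (oblique_dir A (s (Suc k)) (s (Suc (Suc k)))))\<^sup>2) *\<^sub>R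
        oblique_dir A (s (Suc k)) (s (Suc (Suc k)))"
proof -
  have "b $ q = row q A \<bullet> z" for q
    using assms by (auto simp: matrix_vector_mult_def inner_vec_def row_def)
  then show ?thesis
    by (simp add: Let_def inner_diff_right diff_divide_distrib scaleR_diff_left)
qed

text \<open>If consecutive indices coincide, then the direction is \<open>0\<close>, and since
  \<open>x / 0 = 0\<close> the iterate does not move.\<close>

lemma rko_error_orthogonal_last:
  fixes A :: "real^'n^'m"
  assumes "A *v z = b" and nz: "\<And>p. row p A \<noteq> 0" and "k \<ge> 1"
  shows "row (s k) A \<bullet> (rko A b x0 s k - z) = 0"
  using \<open>k \<ge> 1\<close>
proof (induction k rule: dec_induct)
  case base
  have "b $ q = row q A \<bullet> z" for q
    using assms(1) by (auto simp: matrix_vector_mult_def inner_vec_def row_def)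
  then show ?case
    using nz by (simp add: inner_diff_right inner_add_right power2_norm_eq_inner)
next
  case (step k)
  obtain j where k: "k = Suc j" using step(1) by (cases k) auto
  let ?w = "oblique_dir A (s (Suc j)) (s (Suc (Suc j)))"
  show ?case
  proof (cases "?w = 0")
    case True
    \<comment> \<open>The new row is a multiple of the last one, so the old orthogonality carries
      over to it.\<close>
    then have "row (s (Suc (Suc j))) A =
        ((row (s (Suc j)) A \<bullet> row (s (Suc (Suc j))) A) / (norm (row (s (Suc j)) A))\<^sup>2) *\<^sub>R row (s (Suc j)) A"
      by (simp add: oblique_dir_def)
    moreover have "rko A b x0 s (Suc (Suc j)) - z = rko A b x0 s (Suc j) - z"
      using True by (simp add: Let_def)
    ultimately show ?thesis
      using step.IH unfolding k by (metis inner_scaleR_left mult_zero_right)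
  next
    case False
    then show ?thesis
      unfolding k rko_error_step[OF assms(1)]
      by (simp add: inner_diff_right norm_oblique_dir(2)[OF nz] del: rko.simps)
  qed
qed

text \<open>The last step moved orthogonally to the previous row, so the orthogonality gained one
  step earlier survives.\<close>

lemma rko_error_orthogonal_previous:
  fixes A :: "real^'n^'m"
  assumes "A *v z = b" and nz: "\<And>p. row p A \<noteq> 0" and "k \<ge> 2"
  shows "row (s (k - 1)) A \<bullet> (rko A b x0 s k - z) = 0"
proof -
  obtain j where k: "k = Suc (Suc j)" using assms(3) by (metis Suc_le_D numeral_2_eq_2 Suc_le_mono)
  have "row (s (Suc j)) A \<bullet> (rko A b x0 s (Suc j) - z) = 0"
    using assms by (intro rko_error_orthogonal_last) auto
  then show ?thesis
    unfolding k rko_error_step[OF assms(1)]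
    by (simp add: inner_diff_right row_inner_oblique_dir[OF nz] del: rko.simps)
qed

text \<open>Since the error is orthogonal to the last row, its inner products with the new row and
  with the direction agree. The step thus removes the component along the direction, and Pythagoras
  applies.\<close>

lemma norm_rko_error_step:
  fixes A :: "real^'n^'m"
  assumes "A *v z = b" and nz: "\<And>p. row p A \<noteq> 0"
  shows "(norm (rko A b x0 s (Suc (Suc k)) - z))\<^sup>2 =
    (norm (rko A b x0 s (Suc k) - z))\<^sup>2
      - (row (s (Suc (Suc k))) A \<bullet> (rko A b x0 s (Suc k) - z))\<^sup>2 /
          (norm (oblique_dir A (s (Suc k)) (s (Suc (Suc k)))))\<^sup>2"
proof -
  define e where "e = rko A b x0 s (Suc k) - z"
  define w where "w = oblique_dir A (s (Suc k)) (s (Suc (Suc k)))"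
  define r where "r = row (s (Suc (Suc k))) A \<bullet> e"
  have "row (s (Suc k)) A \<bullet> e = 0"
    unfolding e_def using assms by (intro rko_error_orthogonal_last) auto
  then have we: "w \<bullet> e = r"
    by (simp add: w_def r_def oblique_dir_def inner_diff_left)
  have "(norm (e - (r / (norm w)\<^sup>2) *\<^sub>R w))\<^sup>2 = (norm e)\<^sup>2 - r\<^sup>2 / (norm w)\<^sup>2"
  proof (cases "w = 0")
    case False
    have "(norm (e - c *\<^sub>R w))\<^sup>2 = (norm e)\<^sup>2 - 2 * c * r + c\<^sup>2 * (norm w)\<^sup>2" for c
      unfolding power2_norm_eq_inner using we
      by (simp add: inner_simps inner_commute algebra_simps power2_eq_square[of c])
    from this[of "r / (norm w)\<^sup>2"] show ?thesis
      using False by (simp add: power2_eq_square field_simps)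
  qed simp
  then show ?thesis unfolding rko_error_step[OF assms(1)] e_def w_def r_def .
qed

text \<open>The deterministic core: for a fixed history \<open>h\<close>, the conditional
  expectation is a finite sum over the index \<open>j\<close> appended to it.\<close>

lemma rko_mean_contraction:
  fixes A :: "real^'n^'m" and b :: "real^'m" and h :: "nat \<Rightarrow> 'm"
  assumes m: "CARD('m) > 2"
    and nz: "\<And>p. row p A \<noteq> 0"
    and indep: "\<And>p q. p \<noteq> q \<Longrightarrow> row p A \<noteq> row q A \<and> independent {row p A, row q A}"
    and x0: "x0 \<in> range (\<lambda>y. transpose A *v y)"
    and z: "z \<in> range (\<lambda>y. transpose A *v y)" "A *v z = b"
    and k: "k \<ge> 2" and h: "h k \<noteq> h (k - 1)"
  shows "(\<Sum>j\<in>UNIV. pmf (pmf_of_set (UNIV - {h k, h (k - 1)})) j *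
            (norm (rko A b x0 (h(k + 1 := j)) (k + 1) - z))\<^sup>2)
      \<le> (1 - (sigma_min A)\<^sup>2 /
              ((real CARD('m) - 2) * ((frobenius_norm A)\<^sup>2 - (sigma_min A)\<^sup>2)))
          * (norm (rko A b x0 h k - z))\<^sup>2"
proof -
  define e where "e = rko A b x0 h k - z"
  define S where "S = UNIV - {h k, h (k - 1)}"
  define W where "W q = (norm (oblique_dir A (h k) q))\<^sup>2" for q
  define D where "D = (frobenius_norm A)\<^sup>2 - (sigma_min A)\<^sup>2"
  \<comment> \<open>Distinctness of the last two indices gives exactly two excluded rows.\<close>
  have cS: "real (card S) = real CARD('m) - 2"
    using h m by (simp add: S_def card_Diff_subset of_nat_diff)
  have cS0: "real (card S) > 0" using cS m by simp
  then have S: "S \<noteq> {}" "finite S" by auto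
  have A: "A \<noteq> 0" using nz by (auto simp: row_def vec_eq_iff)
  have WD: "W q \<le> D" for q
  proof -
    have "W q \<le> (\<Sum>q\<in>UNIV. W q)" by (rule member_le_sum) (auto simp: W_def)
    also have "\<dots> \<le> D" unfolding W_def D_def by (rule sum_norm_oblique_dir[OF nz])
    finally show ?thesis .
  qed
  have W_pos: "W q > 0" if "q \<noteq> h k" for q
    using oblique_dir_nonzero[of "h k" A q] indep[of "h k" q] that by (simp add: W_def)
  \<comment> \<open>The previous index differs from the last one, so its direction is nonzero; this
    justifies dividing by \<open>D\<close>.\<close>
  have D_pos: "D > 0" using W_pos[of "h (k - 1)"] WD[of "h (k - 1)"] h by simp
  have e0: "row (h k) A \<bullet> e = 0" "row (h (k - 1)) A \<bullet> e = 0"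
    unfolding e_def using rko_error_orthogonal_last[OF z(2) nz]
      rko_error_orthogonal_previous[OF z(2) nz k] k by auto
  have "e \<in> range (\<lambda>y. transpose A *v y)"
    unfolding e_def by (intro subspace_diff subspace_range_transpose rko_in_range_transpose x0 z)
  then have "(sigma_min A * norm e)\<^sup>2 \<le> (norm (A *v e))\<^sup>2"
    using sigma_min_pos_and_le[OF A] by (intro power_mono) (auto simp: less_imp_le)
  also have "\<dots> = (\<Sum>q\<in>UNIV. (row q A \<bullet> e)\<^sup>2)" by (rule sum_row_inner_power2[symmetric])
  also have "\<dots> = (\<Sum>q\<in>S. (row q A \<bullet> e)\<^sup>2)"
    using e0 by (intro sum.mono_neutral_right) (auto simp: S_def)
  also have "\<dots> \<le> (\<Sum>q\<in>S. D * ((row q A \<bullet> e)\<^sup>2 / W q))"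
  proof (rule sum_mono)
    fix q assume "q \<in> S"
    then have "W q > 0" by (intro W_pos) (auto simp: S_def)
    then have "(row q A \<bullet> e)\<^sup>2 = W q * ((row q A \<bullet> e)\<^sup>2 / W q)" by simp
    also have "\<dots> \<le> D * ((row q A \<bullet> e)\<^sup>2 / W q)"
      using \<open>W q > 0\<close> by (intro mult_right_mono WD) auto
    finally show "(row q A \<bullet> e)\<^sup>2 \<le> D * ((row q A \<bullet> e)\<^sup>2 / W q)" .
  qed
  finally have "(sigma_min A)\<^sup>2 * (norm e)\<^sup>2 \<le> D * (\<Sum>q\<in>S. (row q A \<bullet> e)\<^sup>2 / W q)"
    by (simp only: power_mult_distrib sum_distrib_left)
  then have lower: "(sigma_min A)\<^sup>2 / D * (norm e)\<^sup>2 \<le> (\<Sum>q\<in>S. (row q A \<bullet> e)\<^sup>2 / W q)"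
    using D_pos by (simp add: field_simps)
  obtain l where l: "k = Suc l" using k by (cases k) auto
  have step: "(norm (rko A b x0 (h(k + 1 := j)) (k + 1) - z))\<^sup>2 = (norm e)\<^sup>2 - (row j A \<bullet> e)\<^sup>2 / W j" for j
  proof -
    have "rko A b x0 (h(k + 1 := j)) k = rko A b x0 h k" by (rule rko_cong) auto
    then show ?thesis
      using norm_rko_error_step[OF z(2) nz, of x0 "h(k + 1 := j)" l]
      by (simp add: l e_def W_def del: rko.simps)
  qed
  have "(\<Sum>j\<in>UNIV. pmf (pmf_of_set S) j * (norm (rko A b x0 (h(k + 1 := j)) (k + 1) - z))\<^sup>2)
      = (\<Sum>j\<in>S. ((norm e)\<^sup>2 - (row j A \<bullet> e)\<^sup>2 / W j) / real (card S))"
    unfolding step using S by (intro sum.mono_neutral_cong_right) auto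
  also have "\<dots> = (norm e)\<^sup>2 - (\<Sum>j\<in>S. (row j A \<bullet> e)\<^sup>2 / W j) / real (card S)"
    using cS0 S by (simp add: sum_subtractf diff_divide_distrib sum_divide_distrib)
  also have "\<dots> \<le> (norm e)\<^sup>2 - ((sigma_min A)\<^sup>2 / D * (norm e)\<^sup>2) / real (card S)"
    using cS0 by (intro diff_left_mono divide_right_mono lower) auto
  also have "\<dots> = (1 - (sigma_min A)\<^sup>2 / ((real CARD('m) - 2) * D)) * (norm e)\<^sup>2"
    by (simp add: cS algebra_simps)
  finally show ?thesis unfolding S_def D_def e_def .
qed

text \<open>A single nonzero direction makes the denominator positive, and
  \<open>sigma_min A\<close> is positive; hence the inequality is strict.\<close>

lemma contraction_factor_less_1:
  fixes A :: "real^'n^'m"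
  assumes m: "CARD('m) > 2"
    and nz: "\<And>p. row p A \<noteq> 0"
    and indep: "\<And>p q. p \<noteq> q \<Longrightarrow> row p A \<noteq> row q A \<and> independent {row p A, row q A}"
  shows "1 - (sigma_min A)\<^sup>2 /
      ((real CARD('m) - 2) * ((frobenius_norm A)\<^sup>2 - (sigma_min A)\<^sup>2)) < 1"
proof -
  have A: "A \<noteq> 0" using nz by (auto simp: row_def vec_eq_iff)
  have "\<exists>p q::'m. p \<noteq> q"
    using m card_le_Suc0_iff_eq[of "UNIV :: 'm set"] by auto
  then obtain p q :: 'm where pq: "p \<noteq> q" by blast
  have "0 < (norm (oblique_dir A p q))\<^sup>2"
    using oblique_dir_nonzero[of p A q] indep[OF pq] by simp
  also have "\<dots> \<le> (\<Sum>q\<in>UNIV. (norm (oblique_dir A p q))\<^sup>2)"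
    by (rule member_le_sum) auto
  also have "\<dots> \<le> (frobenius_norm A)\<^sup>2 - (sigma_min A)\<^sup>2" by (rule sum_norm_oblique_dir[OF nz])
  finally show ?thesis using m sigma_min_pos_and_le(1)[OF A] by simp
qed

section \<open>Conditioning on the index history\<close>

text \<open>Expand over the finitely many joint atoms. The conditional law \<open>p\<close> enters
  in product form, so histories of probability zero need no separate treatment.\<close>

lemma (in prob_space) expectation_finite_kernel:
  fixes Y :: "'a \<Rightarrow> 'q::finite" and g :: "'h \<Rightarrow> 'q \<Rightarrow> real"
  assumes T: "finite T"
    and H: "H \<in> measurable M (count_space T)" and Y: "Y \<in> measurable M (count_space UNIV)"
    and kernel: "\<And>h j. h \<in> T \<Longrightarrow>
      \<P>(\<omega> in M. H \<omega> = h \<and> Y \<omega> = j) = \<P>(\<omega> in M. H \<omega> = h) * p h j"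
  shows "expectation (\<lambda>\<omega>. g (H \<omega>) (Y \<omega>)) = expectation (\<lambda>\<omega>. \<Sum>j\<in>UNIV. p (H \<omega>) j * g (H \<omega>) j)"
proof -
  have HT: "H \<omega> \<in> T" if "\<omega> \<in> space M" for \<omega> using measurable_space[OF H that] by simp
  have evH: "{\<omega> \<in> space M. H \<omega> = h} \<in> events" for h
    using measurable_sets[OF H, of "{h} \<inter> T"] HT by (auto elim!: back_subst[of "\<lambda>A. A \<in> events"])
  have evY: "{\<omega> \<in> space M. Y \<omega> = j} \<in> events" for j
    using measurable_sets[OF Y, of "{j}"] by (auto elim!: back_subst[of "\<lambda>A. A \<in> events"])
  have evHY: "{\<omega> \<in> space M. H \<omega> = h \<and> Y \<omega> = j} \<in> events" for h j
    using evH evY by auto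
  have "expectation (\<lambda>\<omega>. g (H \<omega>) (Y \<omega>))
      = expectation (\<lambda>\<omega>. \<Sum>h\<in>T. \<Sum>j\<in>UNIV. g h j * indicator {\<omega> \<in> space M. H \<omega> = h \<and> Y \<omega> = j} \<omega>)"
  proof (rule Bochner_Integration.integral_cong)
    fix \<omega> assume \<omega>: "\<omega> \<in> space M"
    have "(\<Sum>h\<in>T. \<Sum>j\<in>UNIV. g h j * indicator {\<omega> \<in> space M. H \<omega> = h \<and> Y \<omega> = j} \<omega>)
        = (\<Sum>h\<in>T. \<Sum>j\<in>UNIV. if H \<omega> = h then if Y \<omega> = j then g h j else 0 else 0)"
      using \<omega> by (intro sum.cong) auto
    also have "\<dots> = (\<Sum>h\<in>T. if H \<omega> = h then g h (Y \<omega>) else 0)"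
      by (intro sum.cong) auto
    also have "\<dots> = g (H \<omega>) (Y \<omega>)" using T HT[OF \<omega>] by simp
    finally show "g (H \<omega>) (Y \<omega>) = (\<Sum>h\<in>T. \<Sum>j\<in>UNIV. g h j * indicator {\<omega> \<in> space M. H \<omega> = h \<and> Y \<omega> = j} \<omega>)" ..
  qed simp
  also have "\<dots> = (\<Sum>h\<in>T. \<Sum>j\<in>UNIV. g h j * \<P>(\<omega> in M. H \<omega> = h \<and> Y \<omega> = j))"
    using evHY by (simp add: Bochner_Integration.integral_sum emeasure_eq_measure del: sum_mult_indicator)
  also have "\<dots> = (\<Sum>h\<in>T. (\<Sum>j\<in>UNIV. p h j * g h j) * \<P>(\<omega> in M. H \<omega> = h))"
    by (simp add: kernel sum_distrib_left sum_distrib_right mult_ac)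
  also have "\<dots> = expectation (\<lambda>\<omega>. \<Sum>h\<in>T. (\<Sum>j\<in>UNIV. p h j * g h j) * indicator {\<omega> \<in> space M. H \<omega> = h} \<omega>)"
    using evH by (simp add: Bochner_Integration.integral_sum emeasure_eq_measure del: sum_mult_indicator)
  also have "\<dots> = expectation (\<lambda>\<omega>. \<Sum>j\<in>UNIV. p (H \<omega>) j * g (H \<omega>) j)"
  proof (rule Bochner_Integration.integral_cong)
    fix \<omega> assume \<omega>: "\<omega> \<in> space M"
    have "(\<Sum>h\<in>T. (\<Sum>j\<in>UNIV. p h j * g h j) * indicator {\<omega> \<in> space M. H \<omega> = h} \<omega>)
        = (\<Sum>h\<in>T. if H \<omega> = h then \<Sum>j\<in>UNIV. p h j * g h j else 0)"
      using \<omega> by (intro sum.cong) auto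
    also have "\<dots> = (\<Sum>j\<in>UNIV. p (H \<omega>) j * g (H \<omega>) j)" using T HT[OF \<omega>] by simp
    finally show "(\<Sum>h\<in>T. (\<Sum>j\<in>UNIV. p h j * g h j) * indicator {\<omega> \<in> space M. H \<omega> = h} \<omega>)
        = (\<Sum>j\<in>UNIV. p (H \<omega>) j * g (H \<omega>) j)" .
  qed simp
  finally show ?thesis .
qed

lemma (in prob_space) integrable_finite_range:
  fixes f :: "'h \<Rightarrow> real"
  assumes T: "finite T" and H: "H \<in> measurable M (count_space T)"
  shows "integrable M (\<lambda>\<omega>. f (H \<omega>))"
proof (rule integrable_const_bound)
  have "(\<lambda>h. f h) \<in> borel_measurable (count_space T)" by simp
  then show "(\<lambda>\<omega>. f (H \<omega>)) \<in> borel_measurable M" using H by measurable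
  show "AE \<omega> in M. norm (f (H \<omega>)) \<le> Max ((\<lambda>h. \<bar>f h\<bar>) ` T)"
    using measurable_space[OF H] T by (intro AE_I2) auto
qed

text \<open>The kernel average is a function of \<open>H\<close>, so only its integrals over
  preimages under \<open>H\<close> remain to be compared.\<close>

lemma (in prob_space) real_cond_exp_finite_kernel:
  fixes Y :: "'a \<Rightarrow> 'q::finite" and g :: "'h \<Rightarrow> 'q \<Rightarrow> real"
  assumes T: "finite T"
    and H: "H \<in> measurable M (count_space T)" and Y: "Y \<in> measurable M (count_space UNIV)"
    and kernel: "\<And>h j. h \<in> T \<Longrightarrow>
      \<P>(\<omega> in M. H \<omega> = h \<and> Y \<omega> = j) = \<P>(\<omega> in M. H \<omega> = h) * p h j"
  defines "F \<equiv> vimage_algebra (space M) H (count_space T)"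
  shows "integrable M (real_cond_exp M F (\<lambda>\<omega>. g (H \<omega>) (Y \<omega>)))"
    and "expectation (real_cond_exp M F (\<lambda>\<omega>. g (H \<omega>) (Y \<omega>))) = expectation (\<lambda>\<omega>. g (H \<omega>) (Y \<omega>))"
    and "AE \<omega> in M. real_cond_exp M F (\<lambda>\<omega>. g (H \<omega>) (Y \<omega>)) \<omega> = (\<Sum>j\<in>UNIV. p (H \<omega>) j * g (H \<omega>) j)"
proof -
  have "H \<in> space M \<rightarrow> T" using measurable_space[OF H] by auto
  then have F: "sets F = {H -` B \<inter> space M | B. B \<subseteq> T}" and HF: "H \<in> measurable F (count_space T)"
    unfolding F_def by (auto simp: sets_vimage_algebra2 intro!: measurable_vimage_algebra1)
  have "subalgebra M F"
    unfolding subalgebra_def F using measurable_sets[OF H] by (auto simp: F_def)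
  then interpret finite_measure_subalgebra M F by unfold_locales
  have "(\<lambda>\<omega>. (H \<omega>, Y \<omega>)) \<in> measurable M (count_space (T \<times> UNIV))"
    using measurable_Pair[OF H Y] by (simp add: pair_measure_countable countable_finite T)
  from integrable_finite_range[OF _ this, of "\<lambda>(h, j). g h j"] T
  have int: "integrable M (\<lambda>\<omega>. g (H \<omega>) (Y \<omega>))" by simp
  then show "integrable M (real_cond_exp M F (\<lambda>\<omega>. g (H \<omega>) (Y \<omega>)))"
    and "expectation (real_cond_exp M F (\<lambda>\<omega>. g (H \<omega>) (Y \<omega>))) = expectation (\<lambda>\<omega>. g (H \<omega>) (Y \<omega>))"
    by (auto intro: real_cond_exp_int)
  show "AE \<omega> in M. real_cond_exp M F (\<lambda>\<omega>. g (H \<omega>) (Y \<omega>)) \<omega> = (\<Sum>j\<in>UNIV. p (H \<omega>) j * g (H \<omega>) j)"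
  proof (rule real_cond_exp_charact[OF _ int])
    fix A assume "A \<in> sets F"
    then obtain B where A: "A = H -` B \<inter> space M" unfolding F by blast
    \<comment> \<open>The indicator of \<open>A\<close> depends on \<open>H\<close> alone and is
      absorbed into \<open>g\<close>.\<close>
    have "(\<integral>\<omega>\<in>A. g (H \<omega>) (Y \<omega>) \<partial>M) = expectation (\<lambda>\<omega>. indicator B (H \<omega>) * g (H \<omega>) (Y \<omega>))"
      unfolding set_lebesgue_integral_def A
      by (intro Bochner_Integration.integral_cong) (auto simp: indicator_def)
    also have "\<dots> = expectation (\<lambda>\<omega>. \<Sum>j\<in>UNIV. p (H \<omega>) j * (indicator B (H \<omega>) * g (H \<omega>) j))"
      by (rule expectation_finite_kernel[OF T H Y kernel])
    also have "\<dots> = (\<integral>\<omega>\<in>A. (\<Sum>j\<in>UNIV. p (H \<omega>) j * g (H \<omega>) j) \<partial>M)"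
      unfolding set_lebesgue_integral_def A
      by (intro Bochner_Integration.integral_cong) (auto simp: indicator_def)
    finally show "(\<integral>\<omega>\<in>A. g (H \<omega>) (Y \<omega>) \<partial>M) = (\<integral>\<omega>\<in>A. (\<Sum>j\<in>UNIV. p (H \<omega>) j * g (H \<omega>) j) \<partial>M)" .
  next
    show "integrable M (\<lambda>\<omega>. \<Sum>j\<in>UNIV. p (H \<omega>) j * g (H \<omega>) j)"
      using integrable_finite_range[OF T H] .
    have "(\<lambda>h. \<Sum>j\<in>UNIV. p h j * g h j) \<in> borel_measurable (count_space T)" by simp
    from measurable_compose[OF HF this]
    show "(\<lambda>\<omega>. \<Sum>j\<in>UNIV. p (H \<omega>) j * g (H \<omega>) j) \<in> borel_measurable F" .
  qed
qed

section \<open>The index history as one finite-valued random variable\<close>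

text \<open>Restriction fixes the values outside \<open>{1..k}\<close>, so that only finitely many
  prefixes exist.\<close>

definition index_prefix :: "(nat \<Rightarrow> 'w \<Rightarrow> 'm) \<Rightarrow> nat \<Rightarrow> 'w \<Rightarrow> nat \<Rightarrow> 'm" where
  "index_prefix i k \<omega> = (\<lambda>l\<in>{1..k}. i l \<omega>)"

lemma finite_index_prefix_range: "finite ({1..k} \<rightarrow>\<^sub>E (UNIV :: 'm::finite set))" for k :: nat
  by (intro finite_PiE) auto

lemma index_prefix_eq_iff:
  assumes "h \<in> {1..k} \<rightarrow>\<^sub>E UNIV"
  shows "index_prefix i k \<omega> = h \<longleftrightarrow> (\<forall>l\<in>{1..k}. i l \<omega> = h l)"
  unfolding index_prefix_def using assms
  by (metis PiE_restrict restrict_apply' restrict_ext)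

lemma measurable_index_prefix:
  fixes i :: "nat \<Rightarrow> 'w \<Rightarrow> 'm::finite"
  assumes "\<And>l. l \<in> {1..k} \<Longrightarrow> i l \<in> measurable M (count_space UNIV)"
  shows "index_prefix i k \<in> measurable M (count_space ({1..k} \<rightarrow>\<^sub>E UNIV))"
  unfolding measurable_count_space_eq2[OF finite_index_prefix_range]
proof (intro conjI ballI)
  show "index_prefix i k \<in> space M \<rightarrow> {1..k} \<rightarrow>\<^sub>E UNIV" by (auto simp: index_prefix_def)
  fix h :: "nat \<Rightarrow> 'm" assume "h \<in> {1..k} \<rightarrow>\<^sub>E UNIV"
  then have "index_prefix i k -` {h} \<inter> space M = {\<omega> \<in> space M. \<forall>l\<in>{1..k}. i l \<omega> = h l}"
    using index_prefix_eq_iff[of h k i] by blast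
  also have "\<dots> \<in> sets M"
  proof (rule sets.sets_Collect_finite_All)
    fix l assume "l \<in> {1..k}"
    from measurable_sets[OF assms[OF this], of "{h l}"]
    show "{\<omega> \<in> space M. i l \<omega> = h l} \<in> sets M" by (simp add: vimage_def Int_def conj_commute)
  qed simp
  finally show "index_prefix i k -` {h} \<inter> space M \<in> sets M" .
qed

text \<open>Connects the generators of \<open>history\<close> with the single variable to which the
  finite-kernel lemma applies.\<close>

lemma history_eq_vimage_algebra:
  fixes i :: "nat \<Rightarrow> 'w \<Rightarrow> 'm::finite"
  shows "history M i k = vimage_algebra (space M) (index_prefix i k) (count_space ({1..k} \<rightarrow>\<^sub>E UNIV))"
    (is "_ = ?F")
proof -
  let ?G = "{i l -` S \<inter> space M | l S. l \<in> {1..k}}"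
  let ?T = "{1..k} \<rightarrow>\<^sub>E (UNIV :: 'm set)"
  have hist: "i l \<in> measurable (history M i k) (count_space UNIV)" if "l \<in> {1..k}" for l
    using that unfolding history_def
    by (intro measurableI) (auto simp: space_measure_of_conv sets_measure_of_conv)
  have "sets (history M i k) = sets ?F"
  proof (rule antisym)
    show "sets ?F \<subseteq> sets (history M i k)"
      by (intro sets_image_in_sets measurable_index_prefix hist)
        (simp_all add: history_def space_measure_of_conv)
    have "?G \<subseteq> sets ?F"
    proof safe
      fix l S assume l: "l \<in> {1..k}"
      have "i l -` S \<inter> space M = index_prefix i k -` {h \<in> ?T. h l \<in> S} \<inter> space M"
        using l by (auto simp: index_prefix_def)
      also have "\<dots> \<in> sets ?F" by (rule in_vimage_algebra) simp
      finally show "i l -` S \<inter> space M \<in> sets ?F" .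
    qed
    then have "sigma_sets (space M) ?G \<subseteq> sets ?F"
      using sets.sigma_sets_subset[of ?G ?F] by simp
    moreover have "?G \<subseteq> Pow (space M)" by blast
    ultimately show "sets (history M i k) \<subseteq> sets ?F"
      unfolding history_def by (simp only: sets_measure_of)
  qed
  \<comment> \<open>Equality as measures also compares the measures of sets; both sides carry the
    zero measure.\<close>
  then show ?thesis
    by (intro measure_eqI) (simp_all add: history_def vimage_algebra_def emeasure_sigma)
qed

text \<open>For a history of probability zero, about which the selection rule is silent, both sides
  vanish; otherwise multiply out the conditional probability.\<close>

lemma rko_selection_kernel:
  fixes i :: "nat \<Rightarrow> 'w \<Rightarrow> 'm::finite"
  assumes "prob_space M" and sel: "rko_selection M i" and k: "k \<ge> 2" and h: "h \<in> {1..k} \<rightarrow>\<^sub>E UNIV"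
  shows "\<P>(\<omega> in M. index_prefix i k \<omega> = h \<and> i (k + 1) \<omega> = j)
      = \<P>(\<omega> in M. index_prefix i k \<omega> = h) * pmf (pmf_of_set (UNIV - {h k, h (k - 1)})) j"
proof -
  interpret prob_space M by fact
  have H: "index_prefix i k \<in> measurable M (count_space ({1..k} \<rightarrow>\<^sub>E UNIV))"
    using sel by (intro measurable_index_prefix) (auto simp: rko_selection_def)
  have "{\<omega> \<in> space M. index_prefix i k \<omega> = h} = index_prefix i k -` {h} \<inter> space M" by blast
  also have "\<dots> \<in> events" using h by (intro measurable_sets[OF H]) simp
  finally have ev: "{\<omega> \<in> space M. index_prefix i k \<omega> = h} \<in> events" .
  show ?thesis
  proof (cases "\<P>(\<omega> in M. index_prefix i k \<omega> = h) = 0")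
    case True
    have "\<P>(\<omega> in M. index_prefix i k \<omega> = h \<and> i (k + 1) \<omega> = j) \<le> \<P>(\<omega> in M. index_prefix i k \<omega> = h)"
      by (intro finite_measure_mono ev) auto
    then have "\<P>(\<omega> in M. index_prefix i k \<omega> = h \<and> i (k + 1) \<omega> = j) = 0"
      unfolding True by (simp add: measure_le_0_iff)
    then show ?thesis unfolding True by simp
  next
    case False
    have "\<forall>k\<ge>2. \<forall>h j. \<P>(\<omega> in M. \<forall>l\<in>{1..k}. i l \<omega> = h l) \<noteq> 0 \<longrightarrow>
        \<P>(\<omega> in M. i (k + 1) \<omega> = j \<bar> \<forall>l\<in>{1..k}. i l \<omega> = h l) =
          pmf (pmf_of_set (UNIV - {h k, h (k - 1)})) j"
      using sel unfolding rko_selection_def by (elim conjE)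
    from this[rule_format, OF k, of h j] False
    have "\<P>(\<omega> in M. i (k + 1) \<omega> = j \<bar> index_prefix i k \<omega> = h)
        = pmf (pmf_of_set (UNIV - {h k, h (k - 1)})) j"
      unfolding index_prefix_eq_iff[OF h] by blast
    moreover have "{\<omega> \<in> space M. i (k + 1) \<omega> = j \<and> index_prefix i k \<omega> = h}
        = {\<omega> \<in> space M. index_prefix i k \<omega> = h \<and> i (k + 1) \<omega> = j}" by blast
    ultimately show ?thesis using False by (simp add: cond_prob_def divide_eq_eq mult.commute)
  qed
qed

text \<open>The first pair is distinct by assumption; later, repeating the last index has
  probability zero under each of the finitely many histories.\<close>

lemma rko_selection_consecutive_distinct:
  fixes i :: "nat \<Rightarrow> 'w \<Rightarrow> 'm::finite"
  assumes prob: "prob_space M" and sel: "rko_selection M i" and m: "CARD('m) > 2" and "k \<ge> 2"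
  shows "AE \<omega> in M. i k \<omega> \<noteq> i (k - 1) \<omega>"
proof (cases "k = 2")
  case True
  then show ?thesis using sel by (auto simp: rko_selection_def elim: eventually_mono)
next
  case False
  define n where "n = k - 1"
  have n: "n \<ge> 2" "k = n + 1" using \<open>k \<ge> 2\<close> False by (auto simp: n_def)
  interpret prob_space M by fact
  let ?T = "{1..n} \<rightarrow>\<^sub>E (UNIV :: 'm set)"
  have i: "i l \<in> measurable M (count_space UNIV)" if "l \<ge> 1" for l
    using sel that by (auto simp: rko_selection_def)
  have H: "index_prefix i n \<in> measurable M (count_space ?T)"
    by (intro measurable_index_prefix i) auto
  have "AE \<omega> in M. \<not> (index_prefix i n \<omega> = h \<and> i (n + 1) \<omega> = h n)" if h: "h \<in> ?T" for h
  proof (rule AE_I)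
    let ?N = "{\<omega> \<in> space M. index_prefix i n \<omega> = h \<and> i (n + 1) \<omega> = h n}"
    \<comment> \<open>\<open>pmf_of_set\<close> is unspecified on the empty set; \<open>m\<close>
      makes the set of admissible indices nonempty.\<close>
    have ne: "UNIV - {h n, h (n - 1)} \<noteq> {}"
    proof
      assume "UNIV - {h n, h (n - 1)} = {}"
      then have "CARD('m) \<le> card {h n, h (n - 1)}" by (intro card_mono) auto
      also have "\<dots> \<le> 2" by (simp add: card_insert_if)
      finally show False using m by simp
    qed
    have "prob ?N = 0"
      using rko_selection_kernel[OF prob sel n(1) h, of "h n"] ne by simp
    then show "emeasure M ?N = 0" by (simp add: emeasure_eq_measure)
    have "?N = (index_prefix i n -` {h} \<inter> space M) \<inter> (i (n + 1) -` {h n} \<inter> space M)" by auto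
    also have "\<dots> \<in> events"
      using h by (intro sets.Int measurable_sets[OF H] measurable_sets[OF i]) auto
    finally show "?N \<in> events" .
  qed auto
  then have "AE \<omega> in M. \<forall>h\<in>?T. \<not> (index_prefix i n \<omega> = h \<and> i (n + 1) \<omega> = h n)"
    by (intro AE_finite_allI finite_index_prefix_range)
  then show ?thesis
  proof eventually_elim
    case (elim \<omega>)
    have "index_prefix i n \<omega> \<in> ?T" "index_prefix i n \<omega> n = i n \<omega>" using n by (auto simp: index_prefix_def)
    with elim show ?case by (auto simp: n)
  qed
qed

section \<open>Contraction and convergence\<close>

theorem theorem3p1:
  fixes A :: "real^'n^'m" and b :: "real^'m" and x0 xstar :: "real^'n"
    and M :: "'w measure" and i :: "nat \<Rightarrow> 'w \<Rightarrow> 'm"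
    and X :: "nat \<Rightarrow> 'w \<Rightarrow> real^'n"
  assumes "CARD('m) \<ge> CARD('n)" and "CARD('m) > 2"
    and "\<exists>x. A *v x = b"
    and "\<forall>p. row p A \<noteq> 0"
    and "\<forall>p q. p \<noteq> q \<longrightarrow> row p A \<noteq> row q A \<and> independent {row p A, row q A}"
    and "x0 \<in> range (\<lambda>y. transpose A *v y)"
    and "xstar = pinv A *v b"
    and "prob_space M" and "rko_selection M i"
    and "X = (\<lambda>k \<omega>. rko A b x0 (\<lambda>l. i l \<omega>) k)"
  shows "(\<forall>k\<ge>2. AE \<omega> in M.
            real_cond_exp M (history M i k) (\<lambda>\<omega>'. (norm (X (k + 1) \<omega>' - xstar))\<^sup>2) \<omega>
            \<le> (1 - (sigma_min A)\<^sup>2 /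
                    ((real CARD('m) - 2) * ((frobenius_norm A)\<^sup>2 - (sigma_min A)\<^sup>2)))
                * (norm (X k \<omega> - xstar))\<^sup>2)
       \<and> (\<lambda>k. \<integral>\<omega>. (norm (X k \<omega> - xstar))\<^sup>2 \<partial>M) \<longlonglongrightarrow> 0"
proof -
  define \<rho> where "\<rho> = 1 - (sigma_min A)\<^sup>2 /
    ((real CARD('m) - 2) * ((frobenius_norm A)\<^sup>2 - (sigma_min A)\<^sup>2))"
  define E where "E k \<omega> = (norm (X k \<omega> - xstar))\<^sup>2" for k \<omega>
  interpret prob_space M by fact
  have nz: "\<And>p. row p A \<noteq> 0"
    and indep: "\<And>p q. p \<noteq> q \<Longrightarrow> row p A \<noteq> row q A \<and> independent {row p A, row q A}"
    using assms(4,5) by auto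
  have sol: "A *v xstar = b" using assms(3,7) pinv_solves by blast
  have range: "xstar \<in> range (\<lambda>y. transpose A *v y)"
    unfolding assms(7) by (rule pinv_mult_in_range_transpose)
  have i: "i l \<in> measurable M (count_space UNIV)" if "l \<ge> 1" for l
    using assms(9) that by (auto simp: rko_selection_def)
  have H: "index_prefix i k \<in> measurable M (count_space ({1..k} \<rightarrow>\<^sub>E UNIV))" for k
    by (intro measurable_index_prefix i) auto
  have E_H: "E k \<omega> = (norm (rko A b x0 (index_prefix i k \<omega>) k - xstar))\<^sup>2" for k \<omega>
    unfolding E_def assms(10)
    by (rule arg_cong[of _ _ "\<lambda>x. (norm (x - xstar))\<^sup>2"], rule rko_cong) (simp add: index_prefix_def)
  have int_E: "integrable M (E k)" for k
    unfolding E_H[abs_def] by (rule integrable_finite_range[OF finite_index_prefix_range H])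
  have main: "(AE \<omega> in M. real_cond_exp M (history M i k) (E (k + 1)) \<omega> \<le> \<rho> * E k \<omega>)
      \<and> expectation (E (k + 1)) \<le> \<rho> * expectation (E k)" if k: "k \<ge> 2" for k
  proof -
    define g where "g h j = (norm (rko A b x0 (h(k + 1 := j)) (k + 1) - xstar))\<^sup>2" for h j
    have E_g: "E (k + 1) = (\<lambda>\<omega>. g (index_prefix i k \<omega>) (i (k + 1) \<omega>))"
    proof
      fix \<omega>
      have "rko A b x0 (\<lambda>l. i l \<omega>) (k + 1)
          = rko A b x0 ((index_prefix i k \<omega>)(k + 1 := i (k + 1) \<omega>)) (k + 1)"
        by (rule rko_cong) (auto simp: index_prefix_def)
      then show "E (k + 1) \<omega> = g (index_prefix i k \<omega>) (i (k + 1) \<omega>)"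
        by (simp only: E_def g_def assms(10))
    qed
    have Y: "i (k + 1) \<in> measurable M (count_space UNIV)" by (rule i) simp
    have cond: "integrable M (real_cond_exp M (history M i k) (E (k + 1)))"
      "expectation (real_cond_exp M (history M i k) (E (k + 1))) = expectation (E (k + 1))"
      "AE \<omega> in M. real_cond_exp M (history M i k) (E (k + 1)) \<omega>
        = (\<Sum>j\<in>UNIV. pmf (pmf_of_set (UNIV - {index_prefix i k \<omega> k, index_prefix i k \<omega> (k - 1)})) j
              * g (index_prefix i k \<omega>) j)"
      unfolding E_g history_eq_vimage_algebra
      by (rule real_cond_exp_finite_kernel[OF finite_index_prefix_range H Y],
          erule rko_selection_kernel[OF assms(8,9) k])+
    have AE: "AE \<omega> in M. real_cond_exp M (history M i k) (E (k + 1)) \<omega> \<le> \<rho> * E k \<omega>"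
      using cond(3) rko_selection_consecutive_distinct[OF assms(8,9,2) k]
    proof eventually_elim
      case (elim \<omega>)
      \<comment> \<open>Both indices must lie in \<open>{1..k}\<close>, where the prefix agrees with
        the path.\<close>
      have "1 \<le> k" "1 \<le> k - 1" using k by simp_all
      then have "index_prefix i k \<omega> k \<noteq> index_prefix i k \<omega> (k - 1)"
        using elim(2) by (simp add: index_prefix_def)
      from rko_mean_contraction[where A = A, OF assms(2) nz indep assms(6) range sol k this]
      show ?case unfolding elim(1) g_def \<rho>_def E_H .
    qed
    \<comment> \<open>The tower property turns the almost sure bound into one for full
      expectations.\<close>
    have "expectation (E (k + 1)) = expectation (real_cond_exp M (history M i k) (E (k + 1)))"
      by (rule cond(2)[symmetric])
    also have "\<dots> \<le> expectation (\<lambda>\<omega>. \<rho> * E k \<omega>)"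
      by (intro integral_mono_AE cond(1) AE integrable_mult_right int_E)
    finally show ?thesis using AE by simp
  qed
  \<comment> \<open>The induction multiplies inequalities by the factor, which must be nonnegative;
    the maximum secures this without a lower bound for \<open>\<rho>\<close>.\<close>
  define r where "r = max \<rho> 0"
  have "\<rho> < 1"
    unfolding \<rho>_def by (rule contraction_factor_less_1[OF assms(2) nz indep])
  then have r: "0 \<le> r" "r < 1" by (auto simp: r_def)
  have E_nonneg: "0 \<le> expectation (E k)" for k
    by (simp add: E_def)
  have bound: "expectation (E (n + 2)) \<le> r ^ n * expectation (E 2)" for n
  proof (induction n)
    case (Suc n)
    have "expectation (E (Suc n + 2)) \<le> \<rho> * expectation (E (n + 2))"
      using main[of "n + 2"] by simp
    also have "\<dots> \<le> r * expectation (E (n + 2))"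
      by (intro mult_right_mono E_nonneg) (simp add: r_def)
    also have "\<dots> \<le> r * (r ^ n * expectation (E 2))"
      by (intro mult_left_mono Suc.IH r)
    finally show ?case by (simp add: mult.assoc)
  qed (simp add: numeral_2_eq_2)
  have "(\<lambda>n. r ^ n * expectation (E 2)) \<longlonglongrightarrow> 0"
    using r by (intro tendsto_mult_left_zero LIMSEQ_realpow_zero)
  then have "(\<lambda>n. expectation (E (n + 2))) \<longlonglongrightarrow> 0"
    by (rule tendsto_sandwich[OF _ _ tendsto_const, rotated 2]) (use E_nonneg bound in auto)
  then have "(\<lambda>k. expectation (E k)) \<longlonglongrightarrow> 0" by (rule LIMSEQ_offset)
  then show ?thesis using main unfolding E_def \<rho>_def by blast
qed

end
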